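(* As $j\to\infty$, \[ \log 2 \,\frac{j}{\log j} \lesssim \liminf_{r\to+\infty}\frac{\mathsf{D}_j(C_2^r)}{r} \le \limsup_{r\to+\infty}\frac{\mathsf{D}_j(C_2^r)}{r} \lesssim 2\log 2\,\frac{j}{\log j}. \]
   Context: $C_2^r$ denotes the elementary abelian $2$-group of rank $r$. A sequence over a finite abelian group $G$ is a finite list of elements of $G$ (repetitions allowed); subsequences correspond to subsets of indices, are disjoint if their index sets are disjoint, and are zero-sum if their terms sum to $0$. For a positive integer $j$, $\mathsf{D}_j(G)$ is the smallest integer $\ell$ such that every sequence over $G$ of length at least $\ell$ contains $j$ pairwise disjoint non-empty zero-sum subsequences. For positive functions $a(j),b(j)$, $a(j)\lesssim b(j)$ as $j\to\infty$ means $a(j)\le (1+o(1))\,b(j)$, i.e. $\limsup_{j\to\infty} a(j)/b(j)\le 1$. $\log$ is the natural logarithm. *)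

theory Defs
  imports
    "HOL-Algebra.FiniteProduct"
    "HOL-Algebra.Elementary_Groups"
    "HOL-Algebra.Product_Groups"
    "HOL-Library.Extended_Real"
    "HOL-Library.Disjoint_Sets"
begin

definition elementary_2group :: "nat \<Rightarrow> (nat \<Rightarrow> int) monoid" where
  "elementary_2group r = product_group {..<r} (\<lambda>_. integer_mod_group 2)"

text \<open>
  A sequence over \<open>G\<close> is a list, and a subsequence is given by its set of indices. Groups are
  written multiplicatively, as in \<open>HOL-Algebra\<close>, so sums are \<^const>\<open>finprod\<close> and zero is
  \<open>\<one>\<^bsub>G\<^esub>\<close>.
\<close>

definition zero_sum_indices :: "('a, 'b) monoid_scheme \<Rightarrow> 'a list \<Rightarrow> nat set \<Rightarrow> bool" where
  "zero_sum_indices G xs I \<longleftrightarrow>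
     I \<subseteq> {..<length xs} \<and> I \<noteq> {} \<and> finprod G (\<lambda>i. xs ! i) I = \<one>\<^bsub>G\<^esub>"

definition has_disjoint_zero_sums :: "('a, 'b) monoid_scheme \<Rightarrow> nat \<Rightarrow> 'a list \<Rightarrow> bool" where
  "has_disjoint_zero_sums G j xs \<longleftrightarrow>
     (\<exists>S. (\<forall>k<j. zero_sum_indices G xs (S k)) \<and> disjoint_family_on S {..<j})"

definition Davenport :: "nat \<Rightarrow> ('a, 'b) monoid_scheme \<Rightarrow> nat" where
  "Davenport j G =
     (LEAST l. \<forall>xs. set xs \<subseteq> carrier G \<and> length xs \<ge> l \<longrightarrow> has_disjoint_zero_sums G j xs)"

text \<open>
  The lower and upper limits of \<open>D\<^sub>j(C\<^sub>2\<^sup>r) / r\<close> as \<open>r\<close> tends to infinity, in the extended reals.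
\<close>

definition Davenport_liminf :: "nat \<Rightarrow> ereal" where
  "Davenport_liminf j =
     liminf (\<lambda>r. ereal (real (Davenport j (elementary_2group r)) / real r))"

definition Davenport_limsup :: "nat \<Rightarrow> ereal" where
  "Davenport_limsup j =
     limsup (\<lambda>r. ereal (real (Davenport j (elementary_2group r)) / real r))"

text \<open>
  On \<^typ>\<open>ereal\<close> a positive number divided by \<open>0\<close> is \<open>\<infinity>\<close>, so a bound
  \<open>a \<lesssim> b\<close> with \<open>a\<close> eventually positive fails if \<open>b\<close> vanishes infinitely often; likewise it
  fails for \<open>b\<close> real and positive if \<open>a\<close> is infinite infinitely often.
\<close>

definition asymp_le :: "(nat \<Rightarrow> ereal) \<Rightarrow> (nat \<Rightarrow> ereal) \<Rightarrow> bool"  (infix \<open>\<lesssim>\<close> 50) where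
  "a \<lesssim> b \<longleftrightarrow> limsup (\<lambda>j. a j / b j) \<le> 1"

end

theory Submission
  imports Defs "HOL-Real_Asymp.Real_Asymp"
begin

text \<open>
  A sequence over \<open>C\<^sub>2\<^sup>r\<close> is the list of columns of a parity-check matrix, and its zero-sum
  subsequences are the supports of the codewords. For the upper bound, as soon as
  \<open>m choose t > 2\<^sup>r\<close>, any \<open>m\<close> terms contain two distinct \<open>t\<close>-subsets with equal sums, whose
  symmetric difference is a zero-sum subsequence of length at most \<open>2 t\<close> (the Hamming bound).
  Extracting these greedily gives \<open>D\<^sub>j \<le> m + 2 t j\<close>, and one takes \<open>m \<approx> c r\<close> and
  \<open>t \<approx> r ln 2 / ln c\<close> with \<open>c = j / (ln j)\<^sup>2\<close>. For the lower bound, choosing terms greedily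
  (the Varshamov bound) yields a long sequence all of whose zero-sum subsequences are so long
  that \<open>j\<close> of them cannot be disjoint.
\<close>

section \<open>Short zero-sum subsequences in groups of exponent two\<close>

text \<open>Both bounds on \<open>Davenport\<close> use only that the group is finite, abelian and
  of exponent dividing two; beyond this the order of the group is all that enters.\<close>

locale exp2_group = comm_group +
  assumes square: "x \<in> carrier G \<Longrightarrow> x \<otimes> x = \<one>"
    and finite_carrier: "finite (carrier G)"
begin

text \<open>Cancelling the common factor over \<open>A \<inter> B\<close> leaves equal products over
  \<open>A - B\<close> and \<open>B - A\<close>. Their product is then a square, hence
  trivial.\<close>

lemma finprod_sym_diff:
  assumes "finite A" "finite B" "f \<in> A \<union> B \<rightarrow> carrier G"
    and eq: "finprod G f A = finprod G f B"
  shows "finprod G f ((A - B) \<union> (B - A)) = \<one>"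
proof -
  have cl: "finprod G f C \<in> carrier G" if "C \<subseteq> A \<union> B" for C
    using that assms(3) by (intro finprod_closed) auto
  have split: "finprod G f (C \<union> D) = finprod G f C \<otimes> finprod G f D"
    if "C \<subseteq> A \<union> B" "D \<subseteq> A \<union> B" "C \<inter> D = {}" for C D
    using that assms(1-3) by (intro finprod_Un_disjoint) (auto intro: finite_subset)
  have "finprod G f ((A - B) \<union> (A \<inter> B)) = finprod G f (A - B) \<otimes> finprod G f (A \<inter> B)"
    by (rule split) auto
  moreover have "finprod G f ((B - A) \<union> (A \<inter> B)) = finprod G f (B - A) \<otimes> finprod G f (A \<inter> B)"
    by (rule split) auto
  moreover have "(A - B) \<union> (A \<inter> B) = A" "(B - A) \<union> (A \<inter> B) = B"
    by auto
  ultimately have "finprod G f (A - B) = finprod G f (B - A)"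
    using eq cl[of "A - B"] cl[of "B - A"] cl[of "A \<inter> B"] by (simp add: le_supI1 le_supI2 subset_iff)
  moreover have "finprod G f ((A - B) \<union> (B - A)) = finprod G f (A - B) \<otimes> finprod G f (B - A)"
    by (rule split) auto
  ultimately show ?thesis
    using square[OF cl[of "B - A"]] by auto
qed

text \<open>Pigeonhole on the \<open>t\<close>-subsets of \<open>U\<close>. Allowing any index set
  \<open>U\<close> lets the lemma be reapplied after some indices have been removed.\<close>

lemma short_zero_sum:
  assumes xs: "set xs \<subseteq> carrier G" and U: "U \<subseteq> {..<length xs}" "m \<le> card U"
    and m: "card (carrier G) < m choose t"
  shows "\<exists>I. I \<subseteq> U \<and> zero_sum_indices G xs I \<and> card I \<le> 2 * t"
proof -
  define F where "F = finprod G (\<lambda>i. xs ! i)"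
  define T where "T = {A. A \<subseteq> U \<and> card A = t}"
  have finU: "finite U"
    using U(1) finite_subset by blast
  have in_carrier: "(\<lambda>i. xs ! i) \<in> A \<rightarrow> carrier G" if "A \<subseteq> U" for A
    using that U(1) xs by (auto simp: subset_iff)
  have "card (F ` T) \<le> card (carrier G)"
    using in_carrier by (intro card_mono finite_carrier) (auto simp: F_def T_def intro!: finprod_closed)
  also have "\<dots> < m choose t"
    by (rule m)
  also have "\<dots> \<le> card U choose t"
    by (rule binomial_right_mono) (rule U)
  also have "\<dots> = card T"
    unfolding T_def by (rule n_subsets[symmetric]) (rule finU)
  finally have "\<not> inj_on F T"
    by (rule pigeonhole)
  then obtain A B where AB: "A \<in> T" "B \<in> T" "A \<noteq> B" "F A = F B"
    by (auto simp: inj_on_def)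
  have fin: "finite A" "finite B"
    using AB finU by (auto simp: T_def intro: finite_subset)
  define I where "I = (A - B) \<union> (B - A)"
  have "finprod G (\<lambda>i. xs ! i) I = \<one>"
    unfolding I_def using AB in_carrier[of "A \<union> B"] fin
    by (intro finprod_sym_diff) (auto simp: F_def T_def)
  moreover have "I \<subseteq> U" "I \<noteq> {}"
    using AB by (auto simp: I_def T_def)
  moreover have "card I \<le> card A + card B"
    unfolding I_def using fin
    by (intro order.trans[OF card_Un_le] add_mono card_mono) auto
  ultimately show ?thesis
    using U(1) AB by (intro exI[of _ I]) (auto simp: zero_sum_indices_def T_def)
qed

text \<open>Greedy extraction: each round consumes at most \<open>2 * t\<close> indices, so at least
  \<open>m\<close> are available whenever a further subsequence is sought.\<close>

lemma disjoint_zero_sums_within: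
  assumes xs: "set xs \<subseteq> carrier G" and m: "card (carrier G) < m choose t"
    and "U \<subseteq> {..<length xs}" "m + 2 * t * j \<le> card U"
  shows "\<exists>S. (\<forall>k<j. zero_sum_indices G xs (S k) \<and> S k \<subseteq> U) \<and> disjoint_family_on S {..<j}"
  using assms(3,4)
proof (induction j arbitrary: U)
  case 0
  then show ?case
    by (simp add: disjoint_family_on_def)
next
  case (Suc j)
  obtain I where I: "I \<subseteq> U" "zero_sum_indices G xs I" "card I \<le> 2 * t"
    using short_zero_sum[OF xs Suc.prems(1) _ m] Suc.prems(2) by auto
  have "m + 2 * t * j \<le> card U - card I"
    using Suc.prems(2) I(3) by simp
  also have "\<dots> \<le> card (U - I)"
    by (rule diff_card_le_card_Diff) (use I Suc.prems(1) in \<open>auto intro: finite_subset\<close>)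
  finally obtain S where S: "\<forall>k<j. zero_sum_indices G xs (S k) \<and> S k \<subseteq> U - I"
      "disjoint_family_on S {..<j}"
    using Suc.IH[of "U - I"] Suc.prems(1) by (meson Diff_subset order.trans)
  have "disjoint_family_on (S(j := I)) {..<Suc j}"
    using S by (auto simp: disjoint_family_on_def less_Suc_eq) blast+
  moreover have "\<forall>k<Suc j. zero_sum_indices G xs ((S(j := I)) k) \<and> (S(j := I)) k \<subseteq> U"
    using S(1) I by (auto simp: less_Suc_eq)
  ultimately show ?case
    by blast
qed

lemma has_disjoint_zero_sums_if_long:
  assumes "card (carrier G) < m choose t" "set xs \<subseteq> carrier G" "m + 2 * t * j \<le> length xs"
  shows "has_disjoint_zero_sums G j xs"
  using disjoint_zero_sums_within[OF assms(2,1), of "{..<length xs}" j] assms(3)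
  unfolding has_disjoint_zero_sums_def by auto

lemma Davenport_le:
  assumes "card (carrier G) < m choose t"
  shows "Davenport j G \<le> m + 2 * t * j"
  unfolding Davenport_def using has_disjoint_zero_sums_if_long[OF assms]
  by (intro Least_le) auto

text \<open>The \<open>LEAST\<close> defining \<open>Davenport\<close> has its intended meaning only
  once some length is known to work.\<close>

lemma has_disjoint_zero_sums_if_Davenport_le:
  assumes "set xs \<subseteq> carrier G" "Davenport j G \<le> length xs"
  shows "has_disjoint_zero_sums G j xs"
proof -
  let ?P = "\<lambda>l. \<forall>xs. set xs \<subseteq> carrier G \<and> l \<le> length xs \<longrightarrow> has_disjoint_zero_sums G j xs"
  \<comment> \<open>The case \<open>t = 1\<close>: among more terms than group elements, two
    coincide and form a zero-sum pair.\<close>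
  have "card (carrier G) < Suc (card (carrier G)) choose 1"
    by simp
  then have "?P (Suc (card (carrier G)) + 2 * 1 * j)"
    using has_disjoint_zero_sums_if_long by blast
  then have "?P (Davenport j G)"
    unfolding Davenport_def by (rule LeastI)
  then show ?thesis
    using assms by blast
qed

section \<open>Sequences without short zero-sum subsequences\<close>

text \<open>There are fewer index sets of size at most \<open>k\<close> than group elements, so
  their sums miss some element.\<close>

lemma avoid_short_sums:
  assumes xs: "set xs \<subseteq> carrier G" and k: "(\<Sum>i\<le>k. length xs choose i) < card (carrier G)"
  obtains g where "g \<in> carrier G"
    "\<And>A. A \<subseteq> {..<length xs} \<Longrightarrow> card A \<le> k \<Longrightarrow> finprod G (\<lambda>i. xs ! i) A \<noteq> g"
proof -
  define T where "T = (\<Union>i\<le>k. {A. A \<subseteq> {..<length xs} \<and> card A = i})"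
  have finT: "finite T"
    unfolding T_def by (intro finite_UN_I) (auto intro: finite_subset[of _ "Pow {..<length xs}"])
  have "card T \<le> (\<Sum>i\<le>k. card {A. A \<subseteq> {..<length xs} \<and> card A = i})"
    unfolding T_def by (rule card_UN_le) simp
  also have "\<dots> = (\<Sum>i\<le>k. length xs choose i)"
    by (simp add: n_subsets)
  finally have "card (finprod G (\<lambda>i. xs ! i) ` T) < card (carrier G)"
    using card_image_le[OF finT, of "finprod G (\<lambda>i. xs ! i)"] k by linarith
  then have "\<not> carrier G \<subseteq> finprod G (\<lambda>i. xs ! i) ` T"
    using card_mono[of "finprod G (\<lambda>i. xs ! i) ` T" "carrier G"] finT by auto
  then obtain g where "g \<in> carrier G" "g \<notin> finprod G (\<lambda>i. xs ! i) ` T"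
    by blast
  then show ?thesis
    by (intro that[of g]) (auto simp: T_def)
qed

text \<open>Varshamov's greedy construction: each appended term avoids all sums of at most
  \<open>k\<close> earlier terms, so no short zero-sum subsequence can use it.\<close>

lemma ex_no_short_zero_sum:
  assumes "(\<Sum>i\<le>k. n choose i) < card (carrier G)"
  shows "\<exists>xs. length xs = n \<and> set xs \<subseteq> carrier G \<and>
           (\<forall>I. zero_sum_indices G xs I \<longrightarrow> k + 1 < card I)"
  using assms
proof (induction n)
  case 0
  show ?case
    by (rule exI[of _ "[]"]) (auto simp: zero_sum_indices_def)
next
  case (Suc n)
  have "(\<Sum>i\<le>k. n choose i) \<le> (\<Sum>i\<le>k. Suc n choose i)"
    by (intro sum_mono binomial_right_mono) simp
  with Suc obtain xs where xs: "length xs = n" "set xs \<subseteq> carrier G"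
      "\<And>I. zero_sum_indices G xs I \<Longrightarrow> k + 1 < card I" and
      k: "(\<Sum>i\<le>k. n choose i) < card (carrier G)"
    by auto
  obtain g where g: "g \<in> carrier G"
      "\<And>A. A \<subseteq> {..<n} \<Longrightarrow> card A \<le> k \<Longrightarrow> finprod G (\<lambda>i. xs ! i) A \<noteq> g"
    using avoid_short_sums[of xs k] xs k by metis
  have "k + 1 < card I" if I: "zero_sum_indices G (xs @ [g]) I" for I
  proof (cases "n \<in> I")
    case False
    then have sub: "I \<subseteq> {..<n}"
      using I xs(1) by (auto simp: zero_sum_indices_def less_Suc_eq subset_iff)
    have "finprod G (\<lambda>i. (xs @ [g]) ! i) I = finprod G (\<lambda>i. xs ! i) I"
      using sub xs(1,2) by (intro finprod_cong') (auto simp: nth_append subset_iff)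
    then have "zero_sum_indices G xs I"
      using I sub xs(1) by (simp add: zero_sum_indices_def)
    then show ?thesis
      by (rule xs)
  next
    case True
    define A where "A = I - {n}"
    have A: "A \<subseteq> {..<n}" "n \<notin> A" "I = insert n A"
      using I xs(1) True by (auto simp: A_def zero_sum_indices_def less_Suc_eq subset_iff)
    then have finA: "finite A"
      using finite_subset by blast
    have incl: "(\<lambda>i. xs ! i) \<in> A \<rightarrow> carrier G"
      using A(1) xs(1,2) by (auto simp: subset_iff)
    define y where "y = finprod G (\<lambda>i. xs ! i) A"
    have y: "y \<in> carrier G"
      unfolding y_def by (rule finprod_closed[OF incl])
    have "finprod G (\<lambda>i. (xs @ [g]) ! i) A = y"
      unfolding y_def using A(1) xs(1,2) by (intro finprod_cong') (auto simp: nth_append subset_iff)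
    moreover have "(\<lambda>i. (xs @ [g]) ! i) \<in> A \<rightarrow> carrier G"
      using A(1) xs(1) incl by (auto simp: nth_append subset_iff Pi_iff)
    moreover have "(xs @ [g]) ! n = g"
      using xs(1) by (simp add: nth_append)
    moreover have "finprod G (\<lambda>i. (xs @ [g]) ! i) (insert n A) = \<one>"
      using I A(3) by (simp add: zero_sum_indices_def)
    ultimately have "g \<otimes> y = \<one>"
      using finprod_insert[OF finA A(2), of "\<lambda>i. (xs @ [g]) ! i"] g(1) xs(1) by simp
    \<comment> \<open>In exponent two \<open>g\<close> is its own inverse, so the remaining terms of
      the zero-sum subsequence sum to \<open>g\<close>.\<close>
    then have "y = g"
      using square[OF g(1)] g(1) y by (metis inv_equality m_comm)
    then have "\<not> card A \<le> k"
      using g(2) A(1) y_def by blast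
    then show ?thesis
      using A finA by simp
  qed
  then show ?case
    using xs g by (intro exI[of _ "xs @ [g]"]) auto
qed

text \<open>If all zero-sum subsequences are longer than \<open>k + 1\<close>, then \<open>j\<close>
  disjoint ones need at least \<open>j * (k + 1)\<close> indices, more than the \<open>n\<close>
  available.\<close>

lemma Davenport_gt:
  assumes "(\<Sum>i\<le>k. n choose i) < card (carrier G)" and n: "n < j * (k + 1)"
  shows "n < Davenport j G"
proof (rule ccontr)
  assume "\<not> n < Davenport j G"
  moreover obtain xs where xs: "length xs = n" "set xs \<subseteq> carrier G"
      "\<And>I. zero_sum_indices G xs I \<Longrightarrow> k + 1 < card I"
    using ex_no_short_zero_sum[OF assms(1)] by blast
  ultimately have "has_disjoint_zero_sums G j xs"
    by (intro has_disjoint_zero_sums_if_Davenport_le) auto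
  then obtain S where S: "\<And>i. i < j \<Longrightarrow> zero_sum_indices G xs (S i)" "disjoint_family_on S {..<j}"
    by (auto simp: has_disjoint_zero_sums_def)
  have sub: "S i \<subseteq> {..<n}" "finite (S i)" if "i < j" for i
    using S(1)[OF that] xs(1) by (auto simp: zero_sum_indices_def intro: finite_subset)
  have "j * (k + 1) = (\<Sum>i<j. k + 1)"
    by simp
  also have "\<dots> \<le> (\<Sum>i<j. card (S i))"
    using S(1) xs(3) by (intro sum_mono) (simp add: less_imp_le)
  also have "\<dots> = card (\<Union>i<j. S i)"
    using S(2) sub by (intro card_UN_disjoint[symmetric]) (auto simp: disjoint_family_on_def)
  also have "\<dots> \<le> card {..<n}"
    using sub by (intro card_mono) auto
  finally show False
    using n by simp
qed

end

section \<open>Elementary abelian 2-groups\<close>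

lemma card_carrier_elementary_2group: "card (carrier (elementary_2group r)) = 2 ^ r"
  by (simp add: elementary_2group_def carrier_integer_mod_group card_PiE)

lemma exp2_group_elementary_2group: "exp2_group (elementary_2group r)"
proof -
  have "group (elementary_2group r)"
    unfolding elementary_2group_def by (rule product_group) simp
  then interpret comm_group "elementary_2group r"
    by (rule group.group_comm_groupI) (simp add: elementary_2group_def add.commute)
  show ?thesis
  proof
    fix x assume "x \<in> carrier (elementary_2group r)"
    have "(a + a) mod 2 = 0" for a :: int
      by presburger
    then show "x \<otimes>\<^bsub>elementary_2group r\<^esub> x = \<one>\<^bsub>elementary_2group r\<^esub>"
      by (simp add: elementary_2group_def)
  next
    show "finite (carrier (elementary_2group r))"
      using card_carrier_elementary_2group[of r] by (intro card_ge_0_finite) simp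
  qed
qed

section \<open>Asymptotics\<close>

text \<open>The terms with \<open>1 / real r\<close> come from rounding \<open>m\<close> and
  \<open>t\<close> to integers; they vanish as \<open>r\<close> grows with \<open>c\<close> and
  \<open>j\<close> fixed.\<close>

lemma Davenport_elementary_2group_le:
  fixes c :: real
  assumes c: "2 \<le> c" and r: "0 < r"
  shows "real (Davenport j (elementary_2group r)) / real r
         \<le> c + 1 / real r + 2 * real j * (ln 2 / ln c + 1 / real r)"
proof -
  \<comment> \<open>The \<open>+ 1\<close> makes \<open>m > c * r\<close>; as
    \<open>t \<le> r\<close>, this gives \<open>m / t > c\<close>. The choice of \<open>t\<close>
    ensures \<open>c ^ t \<ge> 2 ^ r\<close>.\<close>
  define m where "m = nat \<lfloor>c * r\<rfloor> + 1"
  define t where "t = nat \<lceil>r * ln 2 / ln c\<rceil>"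
  have lnc: "0 < ln c" "ln 2 \<le> ln c"
    using c by auto
  have m: "c * r < m" "m \<le> c * r + 1"
    using c by (auto simp: m_def of_nat_nat) linarith
  have q: "0 < r * ln 2 / ln c" "r * ln 2 / ln c \<le> r"
    using lnc r by (auto simp: divide_simps)
  have t: "r * ln 2 / ln c \<le> t" "t \<le> r * ln 2 / ln c + 1"
    using q by (auto simp: t_def of_nat_nat)
  have "0 < t"
    using q by (simp add: t_def)
  have "t \<le> r"
    unfolding t_def using q by (simp add: ceiling_le_iff nat_le_iff)
  have "real r \<le> c * r"
    using c mult_right_mono[of 1 c "real r"] by simp
  then have "real r \<le> m"
    using m(1) by linarith
  with \<open>t \<le> r\<close> have "t \<le> m"
    by simp
  have "c < real m / real t"
  proof -
    have "c * t \<le> c * r"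
      using \<open>t \<le> r\<close> c by simp
    then show ?thesis
      using m(1) \<open>0 < t\<close> by (simp add: pos_less_divide_eq)
  qed
  have "2 ^ r = exp (r * ln 2)"
    by (simp add: exp_of_nat_mult)
  also have "\<dots> \<le> exp (t * ln c)"
    using t(1) lnc by (simp add: divide_le_eq)
  also have "\<dots> = c ^ t"
    using c by (simp add: exp_of_nat_mult)
  also have "\<dots> < (real m / real t) ^ t"
    using \<open>c < real m / real t\<close> c \<open>0 < t\<close> by (intro power_strict_mono) auto
  also have "\<dots> \<le> m choose t"
    using binomial_ge_n_over_k_pow_k[OF \<open>t \<le> m\<close>, where 'a = real] by simp
  finally have "2 ^ r < m choose t"
    using of_nat_less_iff[where 'a = real, of "2 ^ r"] by simp
  then have "Davenport j (elementary_2group r) \<le> m + 2 * t * j"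
    by (intro exp2_group.Davenport_le[OF exp2_group_elementary_2group])
       (simp add: card_carrier_elementary_2group)
  then have "real (Davenport j (elementary_2group r)) \<le> real (m + 2 * t * j)"
    by (simp only: of_nat_le_iff)
  also have "\<dots> = m + 2 * real j * t"
    by simp
  also have "\<dots> \<le> (c * r + 1) + 2 * real j * (r * ln 2 / ln c + 1)"
    using m(2) t(2) by (intro add_mono mult_left_mono) auto
  also have "\<dots> = (c + 1 / real r + 2 * real j * (ln 2 / ln c + 1 / real r)) * r"
    using r lnc by (simp add: field_simps)
  finally show ?thesis
    using r by (simp add: pos_divide_le_eq)
qed

lemma Davenport_limsup_le:
  fixes c :: real
  assumes "2 \<le> c"
  shows "Davenport_limsup j \<le> ereal (c + 2 * real j * (ln 2 / ln c))"
proof -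
  have "(\<lambda>r. c + 1 / real r + 2 * real j * (ln 2 / ln c + 1 / real r))
          \<longlonglongrightarrow> c + 0 + 2 * real j * (ln 2 / ln c + 0)"
    by (intro tendsto_intros lim_1_over_n)
  then have lim: "limsup (\<lambda>r. ereal (c + 1 / real r + 2 * real j * (ln 2 / ln c + 1 / real r)))
      = ereal (c + 2 * real j * (ln 2 / ln c))"
    by (intro lim_imp_Limsup) auto
  have "Davenport_limsup j
      \<le> limsup (\<lambda>r. ereal (c + 1 / real r + 2 * real j * (ln 2 / ln c + 1 / real r)))"
    unfolding Davenport_limsup_def
    by (intro Limsup_mono eventually_mono[OF eventually_gt_at_top[of 0]])
       (use Davenport_elementary_2group_le[OF assms] in auto)
  then show ?thesis
    by (simp only: lim)
qed

text \<open>Rankin's trick: for \<open>x \<le> 1\<close> the weight \<open>x ^ k\<close> is at most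
  each \<open>x ^ i\<close> with \<open>i \<le> k\<close>, and the weighted sum is completed to
  \<open>(1 + x) ^ n\<close>.\<close>

lemma sum_binomial_le_exp:
  fixes x :: real
  assumes x: "0 < x" "x \<le> 1"
  shows "real (\<Sum>i\<le>k. n choose i) \<le> exp (n * x) / x ^ k"
proof -
  have "real (\<Sum>i\<le>k. n choose i) * x ^ k = (\<Sum>i\<le>k. real (n choose i) * x ^ k)"
    by (simp add: sum_distrib_right)
  also have "\<dots> \<le> (\<Sum>i\<le>k. real (n choose i) * x ^ i)"
    using x by (intro sum_mono mult_left_mono power_decreasing) auto
  \<comment> \<open>The \<open>max\<close> covers \<open>k > n\<close> as well; terms with
    \<open>i > n\<close> are zero.\<close>
  also have "\<dots> \<le> (\<Sum>i\<le>max k n. real (n choose i) * x ^ i)"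
    using x by (intro sum_mono2) auto
  also have "\<dots> = (\<Sum>i\<le>n. real (n choose i) * x ^ i)"
    by (intro sum.mono_neutral_right) (auto simp: binomial_eq_0)
  also have "\<dots> = (x + 1) ^ n"
    by (simp add: binomial_ring)
  also have "\<dots> \<le> exp x ^ n"
    using x exp_ge_add_one_self[of x] by (intro power_mono) (auto simp: add.commute)
  also have "\<dots> = exp (n * x)"
    by (simp add: exp_of_nat_mult)
  finally show ?thesis
    using x by (simp add: pos_le_divide_eq)
qed

lemma Davenport_elementary_2group_ge:
  assumes j: "1 \<le> j" and r: "0 < r"
  shows "real j * ln 2 / (2 + ln (real j)) \<le> real (Davenport j (elementary_2group r)) / real r"
proof -
  \<comment> \<open>With \<open>x = 1 / j\<close> the binomial sum is at most
    \<open>exp (c * r / j * (1 + ln j))\<close>. Having 2 instead of 1 in the denominator keeps this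
    strictly below \<open>2 ^ r\<close>.\<close>
  define c where "c = real j * ln 2 / (2 + ln (real j))"
  define n where "n = nat \<lfloor>c * r\<rfloor>"
  define k where "k = nat \<lfloor>c * r / j\<rfloor>"
  have lnj: "0 \<le> ln (real j)"
    using j by simp
  have c: "0 < c"
    using j lnj by (auto simp: c_def intro!: divide_pos_pos mult_pos_pos add_pos_nonneg)
  have n: "n \<le> c * r" "c * r < n + 1"
    using c by (auto simp: n_def of_nat_nat) linarith
  have "0 \<le> c * r / j"
    using c by simp
  then have k: "k \<le> c * r / j" "c * r / j < k + 1"
    by (auto simp: k_def of_nat_nat) linarith
  have "real (\<Sum>i\<le>k. n choose i) \<le> exp (n * (1 / j)) / (1 / j) ^ k"
    using j by (intro sum_binomial_le_exp) auto
  also have "\<dots> = exp (n / j + k * ln j)"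
    using j by (simp add: exp_add exp_of_nat_mult power_one_over)
  also have "\<dots> \<le> exp (c * r / j + c * r / j * ln j)"
    using n(1) k(1) lnj by (subst exp_le_cancel_iff) (intro add_mono mult_right_mono divide_right_mono; simp)
  also have "c * r / j + c * r / j * ln j = r * ln 2 * ((1 + ln j) / (2 + ln j))"
    using j lnj by (simp add: c_def divide_simps) (simp add: algebra_simps)
  also have "exp (r * ln 2 * ((1 + ln j) / (2 + ln j))) < exp (r * ln 2)"
    using r lnj by (simp add: pos_divide_less_eq)
  also have "\<dots> = real (2 ^ r)"
    by (simp add: exp_of_nat_mult)
  finally have "(\<Sum>i\<le>k. n choose i) < 2 ^ r"
    by (simp only: of_nat_less_iff)
  moreover have "n < j * (k + 1)"
  proof -
    have "c * r < (k + 1) * real j"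
      using k(2) j by (simp add: pos_divide_less_eq)
    with n(1) have "real n < real (j * (k + 1))"
      by (simp add: algebra_simps)
    then show ?thesis
      by (simp only: of_nat_less_iff)
  qed
  ultimately have "n < Davenport j (elementary_2group r)"
    by (intro exp2_group.Davenport_gt[OF exp2_group_elementary_2group])
       (simp_all add: card_carrier_elementary_2group)
  \<comment> \<open>\<open>Davenport\<close> is at least \<open>n + 1\<close>, which exceeds
    \<open>c * r\<close>, so rounding \<open>n\<close> down costs nothing.\<close>
  with n(2) have "c * r \<le> Davenport j (elementary_2group r)"
    by linarith
  then show ?thesis
    using r by (simp add: pos_le_divide_eq c_def)
qed

lemma Davenport_liminf_ge:
  assumes "1 \<le> j"
  shows "ereal (real j * ln 2 / (2 + ln (real j))) \<le> Davenport_liminf j"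
  unfolding Davenport_liminf_def
  by (intro Liminf_bounded eventually_mono[OF eventually_gt_at_top[of 0]])
     (use Davenport_elementary_2group_ge[OF assms] in auto)

section \<open>Letting \<open>j\<close> tend to infinity\<close>

text \<open>Reduces an extended real quotient to a real sequence \<open>h\<close>, whose limit
  \<open>real_asymp\<close> can compute.\<close>

lemma asymp_leI:
  fixes a b :: "nat \<Rightarrow> ereal"
  assumes "eventually (\<lambda>j. a j / b j \<le> ereal (h j)) sequentially" and "h \<longlonglongrightarrow> 1"
  shows "a \<lesssim> b"
proof -
  have "limsup (\<lambda>j. a j / b j) \<le> limsup (\<lambda>j. ereal (h j))"
    using assms(1) by (rule Limsup_mono)
  also have "\<dots> = 1"
    using assms(2) by (intro lim_imp_Limsup) (auto simp: one_ereal_def)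
  finally show ?thesis
    by (simp add: asymp_le_def)
qed

theorem theorem2:
  shows "(\<lambda>j. ereal (ln 2 * (real j / ln (real j)))) \<lesssim> Davenport_liminf
       \<and> (\<forall>j\<ge>1. Davenport_liminf j \<le> Davenport_limsup j)
       \<and> Davenport_limsup \<lesssim> (\<lambda>j. ereal (2 * ln 2 * (real j / ln (real j))))"
proof (intro conjI allI impI)
  show "(\<lambda>j. ereal (ln 2 * (real j / ln (real j)))) \<lesssim> Davenport_liminf"
  proof (rule asymp_leI)
    show "(\<lambda>j. (2 + ln (real j)) / ln (real j)) \<longlonglongrightarrow> 1"
      by real_asymp
    show "\<forall>\<^sub>F j in sequentially. ereal (ln 2 * (real j / ln (real j))) / Davenport_liminf j
            \<le> ereal ((2 + ln (real j)) / ln (real j))"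
      using eventually_gt_at_top[of 1]
    proof eventually_elim
      case (elim j)
      define d where "d = real j * ln 2 / (2 + ln (real j))"
      have lnj: "0 < ln (real j)"
        using elim by simp
      then have d: "0 < d"
        using elim by (auto simp: d_def intro!: divide_pos_pos mult_pos_pos add_pos_nonneg)
      have lim: "ereal d \<le> Davenport_liminf j"
        unfolding d_def by (rule Davenport_liminf_ge) (use elim in simp)
      have "ereal (ln 2 * (real j / ln (real j))) / Davenport_liminf j
          \<le> ereal (ln 2 * (real j / ln (real j))) / ereal d"
        \<comment> \<open>Enlarging the denominator decreases the quotient because both denominators
          are positive.\<close>
        using lim elim lnj d less_le_trans[OF _ lim, of 0]
        by (intro ereal_divide_left_mono) (auto simp: ereal_zero_less_0_iff)
      also have "\<dots> = ereal ((2 + ln (real j)) / ln (real j))"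
        using d lnj elim add_pos_pos[of 2 "ln (real j)"] by (simp add: d_def field_simps)
      finally show ?case .
    qed
  qed
next
  fix j :: nat
  show "Davenport_liminf j \<le> Davenport_limsup j"
    unfolding Davenport_liminf_def Davenport_limsup_def by (rule Liminf_le_Limsup) simp
next
  \<comment> \<open>This \<open>c\<close> is negligible against \<open>j / ln j\<close>, while
    \<open>ln (c j)\<close> is asymptotic to \<open>ln j\<close>; hence the term
    \<open>2 * j * ln 2 / ln (c j)\<close> dominates and matches \<open>b\<close>.\<close>
  define c where "c j = real j / ln (real j) ^ 2" for j :: nat
  define b where "b j = 2 * ln 2 * (real j / ln (real j))" for j :: nat
  have "Davenport_limsup \<lesssim> (\<lambda>j. ereal (b j))"
  proof (rule asymp_leI)
    show "(\<lambda>j. (c j + 2 * real j * (ln 2 / ln (c j))) / b j) \<longlonglongrightarrow> 1"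
      unfolding c_def b_def by real_asymp
    have "\<forall>\<^sub>F j in sequentially. 2 \<le> c j"
      unfolding c_def by real_asymp
    with eventually_gt_at_top[of 1]
    show "\<forall>\<^sub>F j in sequentially. Davenport_limsup j / ereal (b j)
            \<le> ereal ((c j + 2 * real j * (ln 2 / ln (c j))) / b j)"
    proof eventually_elim
      case (elim j)
      then have "0 < b j"
        by (simp add: b_def)
      then show ?case
        using ereal_divide_right_mono[OF Davenport_limsup_le[OF elim(2), of j], of "ereal (b j)"]
        by simp
    qed
  qed
  then show "Davenport_limsup \<lesssim> (\<lambda>j. ereal (2 * ln 2 * (real j / ln (real j))))"
    by (simp add: b_def)
qed

end
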